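(* For any $x>0$ such that $0<F(x)<1$, we have the convergence in distribution $$n^{1/2}\big(\hat F_{n,b}^{\mathrm{IGam}}(x)-\mathbb{E}[\hat F_{n,b}^{\mathrm{IGam}}(x)]\big)\xrightarrow{\ \mathscr D\ }\mathcal N(0,\sigma^2(x)),\quad\text{as } b\to0,\ n\to\infty,$$ where $\sigma^2(x):=F(x)(1-F(x))$. In particular, $$n^{1/2}\big(\hat F_{n,b}^{\mathrm{IGam}}(x)-F(x)\big)\xrightarrow{\ \mathscr D\ }\mathcal N(0,\sigma^2(x)),\quad\text{if } n^{1/2}b\to0,$$ $$n^{1/2}\big(\hat F_{n,b}^{\mathrm{IGam}}(x)-F(x)\big)\xrightarrow{\ \mathscr D\ }\mathcal N\Big(\lambda\cdot\frac{x^2f'(x)}{2},\sigma^2(x)\Big),\quad\text{if } n^{1/2}b\to\lambda,$$ for any constant $\lambda>0$.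
   Context: $F$ is a cumulative distribution function supported on $[0,\infty)$ having two continuous and bounded derivatives; $f=F'$. $X_1,X_2,\dots$ are i.i.d. with c.d.f. $F$. The smoothing parameter $b=b_n>0$ satisfies $b\to0$ as $n\to\infty$. The inverse Gamma kernel c.d.f. estimator is $$\hat F_{n,b}^{\mathrm{IGam}}(x):=\frac1n\sum_{i=1}^n\overline K_{\mathrm{IGam}}(X_i\mid b^{-1}+1,\,x^{-1}b),\qquad \overline K_{\mathrm{IGam}}(t\mid\alpha,\theta):=1-\frac{\Gamma(\alpha,1/(t\theta))}{\Gamma(\alpha)},\quad \alpha,\theta>0,$$ where $\Gamma(\alpha,z):=\int_z^\infty t^{\alpha-1}e^{-t}\,dt$ and $\Gamma(\alpha):=\Gamma(\alpha,0)$. $\mathcal N(m,s^2)$ is the normal distribution with mean $m$ and variance $s^2$; $\xrightarrow{\mathscr D}$ denotes convergence in law. *)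

theory Defs
  imports "HOL-Probability.Probability"
begin

definition upper_Gamma :: "real \<Rightarrow> real \<Rightarrow> real" where
  "upper_Gamma \<alpha> z = (LBINT t:{z..}. t powr (\<alpha> - 1) * exp (- t))"

lemma upper_Gamma_0:
  assumes "\<alpha> > 0"
  shows "upper_Gamma \<alpha> 0 = Gamma \<alpha>"
proof -
  have hi: "((\<lambda>t. t powr (\<alpha> - 1) / exp t) has_integral Gamma \<alpha>) {0..}"
    using Gamma_integral_real[OF assms] .
  have "(\<lambda>t. t powr (\<alpha> - 1) / exp t) absolutely_integrable_on {0..}"
    by (rule nonnegative_absolutely_integrable_1) (use hi in \<open>auto intro: has_integral_integrable\<close>)
  then have "(LINT t:{0..}|lebesgue. t powr (\<alpha> - 1) / exp t) = Gamma \<alpha>"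
    using hi by (simp add: set_lebesgue_integral_eq_integral(2) integral_unique)
  moreover have "(LINT t:{0..}|lebesgue. t powr (\<alpha> - 1) / exp t)
      = (LBINT t:{0..}. t powr (\<alpha> - 1) / exp t)"
    unfolding set_lebesgue_integral_def by (rule integral_completion) measurable
  ultimately show ?thesis
    by (simp add: upper_Gamma_def exp_minus divide_inverse)
qed

text \<open>
  The survival function of the inverse Gamma distribution with shape \<open>\<alpha>\<close> and scale \<open>1 / \<theta>\<close>.
  At \<open>t = 0\<close> the argument \<open>1 / (t * \<theta>)\<close> stands for \<open>\<infinity>\<close>, where the incomplete Gamma function
  vanishes; as \<open>1 / 0 = 0\<close> in HOL, the value 1 is given explicitly. Negative \<open>t\<close>, which occur
  with probability 0 only, are treated in the same way.
\<close>
definition IGam_kernel :: "real \<Rightarrow> real \<Rightarrow> real \<Rightarrow> real" where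
  "IGam_kernel t \<alpha> \<theta> = (if t > 0 then 1 - upper_Gamma \<alpha> (1 / (t * \<theta>)) / Gamma \<alpha> else 1)"

text \<open>The sample of size \<open>n\<close> is \<open>X 0, \<dots>, X (n - 1)\<close>.\<close>
definition IGam_cdf_estimator ::
    "(nat \<Rightarrow> 'a \<Rightarrow> real) \<Rightarrow> nat \<Rightarrow> real \<Rightarrow> real \<Rightarrow> 'a \<Rightarrow> real" where
  "IGam_cdf_estimator X n b x \<omega> =
     1 / real n * (\<Sum>i<n. IGam_kernel (X i \<omega>) (inverse b + 1) (inverse x * b))"

text \<open>The second parameter is the variance, whereas \<open>normal_density\<close> takes the standard deviation.\<close>
definition normal_law :: "real \<Rightarrow> real \<Rightarrow> real measure" where
  "normal_law m v = density lborel (normal_density m (sqrt v))"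

definition conv_in_law :: "'a measure \<Rightarrow> (nat \<Rightarrow> 'a \<Rightarrow> real) \<Rightarrow> real measure \<Rightarrow> bool" where
  "conv_in_law M Y \<mu> \<longleftrightarrow> weak_conv_m (\<lambda>n. distr M borel (Y n)) \<mu>"

end

theory Submission
  imports Defs
begin

text \<open>
  Let \<open>W\<close> be inverse Gamma distributed with shape \<open>1 / b + 1\<close> and scale \<open>x / b\<close>. The kernel at \<open>t\<close>
  is the probability of \<open>W > t\<close>, so by Fubini the estimator has mean \<open>E (F W)\<close>. Since
  \<open>E W = x\<close>, \<open>E (W - x)\<^sup>2 = x\<^sup>2 b / (1 - b)\<close> and \<open>E (W - x)\<^sup>4 = O(b\<^sup>2)\<close>, a second-order expansion of
  \<open>F\<close> at \<open>x\<close> gives the bias \<open>b x\<^sup>2 f'(x) / 2 + o(b)\<close>. By Chebyshev's inequality and dominated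
  convergence the kernels converge in mean square to the indicator of \<open>{..x}\<close>. The centred and
  rescaled estimator therefore differs in mean by \<open>o(1)\<close> from the centred and rescaled empirical
  distribution function, to which the classical central limit theorem applies; comparing
  characteristic functions transfers the limit law.
\<close>

subsection \<open>Transfer of normal limits\<close>

text \<open>The variance of the absolute value is nonnegative. This turns mean-square bounds into
  the bounds in mean that the comparison of characteristic functions takes.\<close>

lemma (in prob_space) abs_expectation_le_sqrt:
  fixes Y :: "'a \<Rightarrow> real"
  assumes [measurable]: "random_variable borel Y" and int: "integrable M (\<lambda>\<omega>. (Y \<omega>)\<^sup>2)"
  shows "expectation (\<lambda>\<omega>. \<bar>Y \<omega>\<bar>) \<le> sqrt (expectation (\<lambda>\<omega>. (Y \<omega>)\<^sup>2))"
proof (rule real_le_rsqrt)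
  have Y: "integrable M Y"
    using square_integrable_imp_integrable[OF _ int] by simp
  have "0 \<le> variance (\<lambda>\<omega>. \<bar>Y \<omega>\<bar>)"
    by (rule variance_positive)
  also have "\<dots> = expectation (\<lambda>\<omega>. (Y \<omega>)\<^sup>2) - (expectation (\<lambda>\<omega>. \<bar>Y \<omega>\<bar>))\<^sup>2"
    using Y int by (subst variance_eq) auto
  finally show "(expectation (\<lambda>\<omega>. \<bar>Y \<omega>\<bar>))\<^sup>2 \<le> expectation (\<lambda>\<omega>. (Y \<omega>)\<^sup>2)" by simp
qed

text \<open>Induction on the index set: the new summand is independent of the sum of the others and
  both are centred, so the cross term has mean 0. Integrability is part of the conclusion because
  the induction has to carry it along.\<close>

lemma (in prob_space) indep_vars_sum_square:
  fixes Z :: "'i \<Rightarrow> 'a \<Rightarrow> real"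
  assumes "finite I" "indep_vars (\<lambda>_. borel) Z I"
    and "\<And>i. i \<in> I \<Longrightarrow> integrable M (\<lambda>\<omega>. (Z i \<omega>)\<^sup>2)"
    and "\<And>i. i \<in> I \<Longrightarrow> expectation (Z i) = 0"
  shows "integrable M (\<lambda>\<omega>. (\<Sum>i\<in>I. Z i \<omega>)\<^sup>2) \<and>
         expectation (\<lambda>\<omega>. (\<Sum>i\<in>I. Z i \<omega>)\<^sup>2) = (\<Sum>i\<in>I. expectation (\<lambda>\<omega>. (Z i \<omega>)\<^sup>2))"
  using assms
proof (induction I rule: finite_induct)
  case empty
  then show ?case by simp
next
  case (insert j I)
  let ?S = "\<lambda>\<omega>. \<Sum>i\<in>I. Z i \<omega>"
  have rv: "random_variable borel (Z i)" if "i \<in> insert j I" for i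
    using insert.prems(1) that by (auto simp: indep_vars_def)
  have int: "integrable M (Z i)" if "i \<in> insert j I" for i
    using square_integrable_imp_integrable[OF rv[OF that] insert.prems(2)[OF that]] .
  have intS: "integrable M ?S"
    using int by auto
  have "indep_vars (\<lambda>_. borel) Z I"
    by (rule indep_vars_subset[OF insert.prems(1)]) auto
  with insert have IH: "integrable M (\<lambda>\<omega>. (?S \<omega>)\<^sup>2)"
    "expectation (\<lambda>\<omega>. (?S \<omega>)\<^sup>2) = (\<Sum>i\<in>I. expectation (\<lambda>\<omega>. (Z i \<omega>)\<^sup>2))"
    by auto
  have ind: "indep_var borel (Z j) borel ?S"
    using insert by (intro indep_vars_sum) auto
  have cross: "integrable M (\<lambda>\<omega>. Z j \<omega> * ?S \<omega>)"
    using int intS by (intro indep_var_integrable[OF ind]) auto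
  have cross0: "expectation (\<lambda>\<omega>. Z j \<omega> * ?S \<omega>) = 0"
    using indep_var_lebesgue_integral[OF ind int intS] insert.prems(3)[of j] by simp
  have *: "(\<lambda>\<omega>. (\<Sum>i\<in>insert j I. Z i \<omega>)\<^sup>2) = (\<lambda>\<omega>. (Z j \<omega>)\<^sup>2 + 2 * (Z j \<omega> * ?S \<omega>) + (?S \<omega>)\<^sup>2)"
    using insert.hyps by (simp add: power2_sum fun_eq_iff algebra_simps)
  show ?case
    unfolding * using insert.prems(2)[of j] cross cross0 IH insert.hyps by simp
qed

section \<open>Characteristic functions and transfer of the limit law\<close>

lemma iexp_diff_le: "cmod (iexp u - iexp v) \<le> \<bar>u - v\<bar>"
proof -
  have "iexp u - iexp v = iexp v * (iexp (u - v) - 1)"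
    by (simp add: algebra_simps flip: exp_add)
  also have "cmod \<dots> = cmod (iexp (u - v) - 1)"
    by (simp add: norm_mult)
  also have "\<dots> \<le> \<bar>u - v\<bar>"
    using iexp_approx1[of "u - v" 0] by simp
  finally show ?thesis .
qed

text \<open>The map \<open>iexp\<close> is 1-Lipschitz on the real line, so two variables on one
  probability space that are close in mean have close characteristic functions.\<close>

lemma (in prob_space) char_distr_diff_le:
  fixes A B :: "'a \<Rightarrow> real"
  assumes [measurable]: "random_variable borel A" "random_variable borel B"
    and int: "integrable M (\<lambda>\<omega>. A \<omega> - B \<omega>)"
  shows "cmod (char (distr M borel A) t - char (distr M borel B) t)
           \<le> \<bar>t\<bar> * expectation (\<lambda>\<omega>. \<bar>A \<omega> - B \<omega>\<bar>)"
proof -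
  have [simp]: "integrable M (\<lambda>\<omega>. iexp (t * A \<omega>))" "integrable M (\<lambda>\<omega>. iexp (t * B \<omega>))"
    by (intro integrable_iexp; simp)+
  have "cmod (char (distr M borel A) t - char (distr M borel B) t)
      = cmod (expectation (\<lambda>\<omega>. iexp (t * A \<omega>) - iexp (t * B \<omega>)))"
    by (simp add: char_def integral_distr del: of_real_mult)
  also have "\<dots> \<le> expectation (\<lambda>\<omega>. cmod (iexp (t * A \<omega>) - iexp (t * B \<omega>)))"
    by (rule integral_norm_bound)
  also have "\<dots> \<le> expectation (\<lambda>\<omega>. \<bar>t\<bar> * \<bar>A \<omega> - B \<omega>\<bar>)"
    using int
  proof (intro integral_mono)
    show "cmod (iexp (t * A \<omega>) - iexp (t * B \<omega>)) \<le> \<bar>t\<bar> * \<bar>A \<omega> - B \<omega>\<bar>" for \<omega>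
      using iexp_diff_le[of "t * A \<omega>" "t * B \<omega>"] by (simp add: abs_mult flip: right_diff_distrib)
  qed (auto simp del: of_real_mult)
  finally show ?thesis by simp
qed

lemma char_distr_affine:
  fixes N :: "real measure"
  assumes "sets N = sets borel"
  shows "char (distr N borel (\<lambda>y. m + s * y)) t = iexp (t * m) * char N (s * t)"
proof -
  have [measurable_cong]: "sets N = sets borel" by fact
  have "char (distr N borel (\<lambda>y. m + s * y)) t = (CLINT y|N. iexp (t * m) * iexp (s * t * y))"
    by (simp add: char_def integral_distr exp_add[symmetric] algebra_simps)
  also have "\<dots> = iexp (t * m) * char N (s * t)"
    by (simp add: char_def)
  finally show ?thesis .
qed

text \<open>Every normal law is an affine image of the standard one, which reduces its
  characteristic function to that of \<open>std_normal_distribution\<close>.\<close>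

lemma normal_law_eq_distr:
  assumes "s > 0"
  shows "normal_law m (s\<^sup>2) = distr std_normal_distribution borel (\<lambda>y. m + s * y)"
proof -
  interpret P: prob_space std_normal_distribution
    by (rule prob_space_normal_density) simp
  have "distributed std_normal_distribution lborel (\<lambda>y. y) std_normal_density"
    by (simp add: distributed_def distr_id2)
  from P.normal_density_affine[OF this, of s m] assms
  have "distributed std_normal_distribution lborel (\<lambda>y. m + s * y) (normal_density m s)"
    by simp
  then have "distr std_normal_distribution lborel (\<lambda>y. m + s * y) = density lborel (normal_density m s)"
    by (simp add: distributed_def)
  \<comment> \<open>\<open>distributed\<close> takes \<open>lborel\<close> as target space, whereas
    \<open>conv_in_law\<close> uses \<open>borel\<close>; the two have the same measurable sets, so
    the image measures agree.\<close>
  moreover have "distr std_normal_distribution lborel (\<lambda>y. m + s * y)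
      = distr std_normal_distribution borel (\<lambda>y. m + s * y)"
    by (rule distr_cong) auto
  ultimately show ?thesis
    using assms by (simp add: normal_law_def)
qed

text \<open>A form of Slutsky's theorem: weak convergence of \<open>S\<close> gives pointwise
  convergence of characteristic functions, the affine map and the error in mean preserve this, and
  Levy's continuity theorem leads back to weak convergence.\<close>

lemma (in prob_space) conv_in_law_normal_affine:
  fixes A S :: "nat \<Rightarrow> 'a \<Rightarrow> real"
  assumes A[measurable]: "\<And>n. random_variable borel (A n)"
    and S[measurable]: "\<And>n. random_variable borel (S n)"
    and conv: "conv_in_law M S std_normal_distribution"
    and s: "s > 0"
    and int: "\<And>n. integrable M (\<lambda>\<omega>. A n \<omega> - (m + s * S n \<omega>))"
    and lim: "(\<lambda>n. expectation (\<lambda>\<omega>. \<bar>A n \<omega> - (m + s * S n \<omega>)\<bar>)) \<longlonglongrightarrow> 0"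
  shows "conv_in_law M A (normal_law m (s\<^sup>2))"
  unfolding conv_in_law_def
proof (rule levy_continuity)
  interpret N: real_distribution std_normal_distribution
    by (rule real_dist_normal_dist)
  show "real_distribution (distr M borel (A n))" for n
    by simp
  show "real_distribution (normal_law m (s\<^sup>2))"
    unfolding normal_law_eq_distr[OF s] by (rule N.real_distribution_distr) simp
  fix t :: real
  let ?B = "\<lambda>n \<omega>. m + s * S n \<omega>"
  have "(\<lambda>n. char (distr M borel (S n)) (s * t)) \<longlonglongrightarrow> char std_normal_distribution (s * t)"
    using conv unfolding conv_in_law_def
    by (intro levy_continuity1 real_dist_normal_dist) auto
  then have "(\<lambda>n. iexp (t * m) * char (distr M borel (S n)) (s * t))
      \<longlonglongrightarrow> iexp (t * m) * char std_normal_distribution (s * t)"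
    by (intro tendsto_intros)
  moreover have "char (distr M borel (?B n)) t = iexp (t * m) * char (distr M borel (S n)) (s * t)" for n
    by (subst char_distr_affine[symmetric]) (simp_all add: distr_distr comp_def)
  moreover have "char (normal_law m (s\<^sup>2)) t = iexp (t * m) * char std_normal_distribution (s * t)"
    unfolding normal_law_eq_distr[OF s] by (subst char_distr_affine) simp_all
  ultimately have lim_B: "(\<lambda>n. char (distr M borel (?B n)) t) \<longlonglongrightarrow> char (normal_law m (s\<^sup>2)) t"
    by presburger
  have lim_diff: "(\<lambda>n. char (distr M borel (A n)) t - char (distr M borel (?B n)) t) \<longlonglongrightarrow> 0"
  proof (rule Lim_null_comparison)
    show "\<forall>\<^sub>F n in sequentially. cmod (char (distr M borel (A n)) t - char (distr M borel (?B n)) t)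
        \<le> \<bar>t\<bar> * expectation (\<lambda>\<omega>. \<bar>A n \<omega> - ?B n \<omega>\<bar>)"
      by (intro always_eventually allI char_distr_diff_le int) auto
    show "(\<lambda>n. \<bar>t\<bar> * expectation (\<lambda>\<omega>. \<bar>A n \<omega> - ?B n \<omega>\<bar>)) \<longlonglongrightarrow> 0"
      using tendsto_mult_right_zero[OF lim] by simp
  qed
  from tendsto_add[OF lim_diff lim_B] show "(\<lambda>n. char (distr M borel (A n)) t) \<longlonglongrightarrow> char (normal_law m (s\<^sup>2)) t"
    by simp
qed

text \<open>The classical central limit theorem is applied to the fixed function \<open>h\<close>
  only. Replacing \<open>h\<close> by \<open>g n\<close> changes the normalised centred sum by a
  variable whose second moment is at most the mean-square distance of \<open>g n\<close> and
  \<open>h\<close>, which tends to 0. The centring constants \<open>c n\<close> then shift the limit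
  by \<open>m\<close>.\<close>

lemma (in prob_space) clt_triangular_perturbation:
  fixes X :: "nat \<Rightarrow> 'a \<Rightarrow> real" and g :: "nat \<Rightarrow> real \<Rightarrow> real" and h :: "real \<Rightarrow> real"
  assumes indep: "indep_vars (\<lambda>_. borel) X UNIV"
    and distr_X: "\<And>i. distr M borel (X i) = N"
    and g[measurable]: "\<And>n. g n \<in> borel_measurable borel"
    and h[measurable]: "h \<in> borel_measurable borel"
    and int_g: "\<And>n. n > 0 \<Longrightarrow> integrable N (\<lambda>y. (g n y)\<^sup>2)"
    and int_h: "integrable N (\<lambda>y. (h y)\<^sup>2)"
    and s: "s > 0" and var: "(\<integral>y. (h y - (\<integral>z. h z \<partial>N))\<^sup>2 \<partial>N) = s\<^sup>2"
    and L2: "(\<lambda>n. \<integral>y. (g n y - h y)\<^sup>2 \<partial>N) \<longlonglongrightarrow> 0"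
    and bias: "(\<lambda>n. sqrt (real n) * ((\<integral>y. g n y \<partial>N) - c n)) \<longlonglongrightarrow> m"
  shows "conv_in_law M (\<lambda>n \<omega>. sqrt (real n) * (1 / real n * (\<Sum>i<n. g n (X i \<omega>)) - c n))
           (normal_law m (s\<^sup>2))"
proof -
  have X[measurable]: "random_variable borel (X i)" for i
    using indep by (auto simp: indep_vars_def)
  interpret N: real_distribution N
    using distr_X[of 0] real_distribution_distr[OF X, of 0] by simp
  have tr: "expectation (\<lambda>\<omega>. k (X i \<omega>)) = (\<integral>y. k y \<partial>N)" "integrable M (\<lambda>\<omega>. k (X i \<omega>)) \<longleftrightarrow> integrable N k"
    if [measurable]: "k \<in> borel_measurable borel" for k :: "real \<Rightarrow> real" and i
    unfolding distr_X[of i, symmetric] by (simp_all add: integral_distr integrable_distr_eq)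
  define \<mu> where "\<mu> = (\<integral>y. h y \<partial>N)"
  define \<nu> where "\<nu> n = (\<integral>y. g n y \<partial>N)" for n
  have int1_h: "integrable N h"
    by (rule N.square_integrable_imp_integrable[OF _ int_h]) simp
  have int1_g: "integrable N (g n)" if "n > 0" for n
    by (rule N.square_integrable_imp_integrable[OF _ int_g[OF that]]) simp
  define S where "S n \<omega> = (\<Sum>i<n. h (X i \<omega>) - \<mu>) / sqrt (real n * s\<^sup>2)" for n \<omega>
  have [measurable]: "random_variable borel (S n)" for n
    unfolding S_def by measurable
  have conv: "conv_in_law M S std_normal_distribution"
    unfolding conv_in_law_def S_def
  proof (rule central_limit_theorem[OF _ _ s])
    show "indep_vars (\<lambda>i. borel) (\<lambda>i \<omega>. h (X i \<omega>)) UNIV"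
      by (rule indep_vars_compose2[OF indep]) simp
    show "expectation (\<lambda>\<omega>. h (X i \<omega>)) = \<mu>" for i
      by (simp add: tr \<mu>_def)
    then show "variance (\<lambda>\<omega>. h (X i \<omega>)) = s\<^sup>2" for i
      using tr(1)[of "\<lambda>y. (h y - \<mu>)\<^sup>2" i] var by (simp add: \<mu>_def)
    show "integrable M (\<lambda>\<omega>. (h (X i \<omega>))\<^sup>2)" for i
      using tr(2)[of "\<lambda>y. (h y)\<^sup>2" i] int_h by simp
    show "distr M borel (\<lambda>\<omega>. h (X i \<omega>)) = distr N borel h" for i
      unfolding distr_X[of i, symmetric] by (simp add: distr_distr comp_def)
  qed
  let ?A = "\<lambda>n \<omega>. sqrt (real n) * (1 / real n * (\<Sum>i<n. g n (X i \<omega>)) - c n)"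
  \<comment> \<open>The first summand bounds the random error, the second is the deterministic error
    of the centring.\<close>
  let ?E = "\<lambda>n. sqrt (\<integral>y. (g n y - h y)\<^sup>2 \<partial>N) + \<bar>sqrt (real n) * (\<nu> n - c n) - m\<bar>"
  have main: "integrable M (\<lambda>\<omega>. ?A n \<omega> - (m + s * S n \<omega>)) \<and>
      expectation (\<lambda>\<omega>. \<bar>?A n \<omega> - (m + s * S n \<omega>)\<bar>) \<le> ?E n" if n: "n > 0" for n
  proof -
    define d where "d y = g n y - h y" for y
    have [measurable]: "d \<in> borel_measurable borel" unfolding d_def by measurable
    have int1_d: "integrable N d" 
      unfolding d_def using int1_h int1_g[OF n] by simp
    have "integrable N (\<lambda>y. 2 * (g n y)\<^sup>2 + 2 * (h y)\<^sup>2)"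
      using int_g[OF n] int_h by simp
    then have int_d: "integrable N (\<lambda>y. (d y)\<^sup>2)"
    proof (rule Bochner_Integration.integrable_bound, goal_cases)
      case 2
      have "(d y)\<^sup>2 \<le> 2 * (g n y)\<^sup>2 + 2 * (h y)\<^sup>2" for y
        unfolding d_def using sum_squares_bound[of "g n y" "- h y"] by (simp add: power2_diff)
      then show ?case by simp
    qed simp
    define Z where "Z i \<omega> = d (X i \<omega>) - (\<nu> n - \<mu>)" for i \<omega>
    have [measurable]: "random_variable borel (Z i)" for i unfolding Z_def by measurable
    have d_mean: "(\<integral>y. d y \<partial>N) = \<nu> n - \<mu>"
      unfolding d_def \<nu>_def \<mu>_def using int1_h int1_g[OF n] by simp
    have int_sq: "integrable N (\<lambda>y. (d y - (\<nu> n - \<mu>))\<^sup>2)"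
      using int_d int1_d by (simp add: power2_diff)
    have Z0: "expectation (Z i) = 0" for i
      using tr(1)[of "\<lambda>y. d y - (\<nu> n - \<mu>)" i] int1_d d_mean N.prob_space
      by (simp add: Z_def[abs_def])
    have Z2: "integrable M (\<lambda>\<omega>. (Z i \<omega>)\<^sup>2)" for i
      using tr(2)[of "\<lambda>y. (d y - (\<nu> n - \<mu>))\<^sup>2" i] int_sq by (simp add: Z_def)
    have Z2_le: "expectation (\<lambda>\<omega>. (Z i \<omega>)\<^sup>2) \<le> (\<integral>y. (d y)\<^sup>2 \<partial>N)" for i
    proof -
      \<comment> \<open>\<open>Z i\<close> is \<open>d (X i)\<close> minus its mean, so its second
        moment is a variance and hence at most the raw second moment of \<open>d\<close>.\<close>
      have "expectation (\<lambda>\<omega>. (Z i \<omega>)\<^sup>2) = N.variance d"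
        using tr(1)[of "\<lambda>y. (d y - (\<nu> n - \<mu>))\<^sup>2" i] by (simp add: Z_def d_mean)
      also have "\<dots> \<le> (\<integral>y. (d y)\<^sup>2 \<partial>N)"
        using int_d int1_d by (subst N.variance_eq) auto
      finally show ?thesis .
    qed
    have "indep_vars (\<lambda>_. borel) (\<lambda>i \<omega>. d (X i \<omega>) - (\<nu> n - \<mu>)) {..<n}"
      by (rule indep_vars_compose2[OF indep_vars_subset[OF indep]]) auto
    then have indZ: "indep_vars (\<lambda>_. borel) Z {..<n}"
      by (simp add: Z_def[abs_def])
    note sq = indep_vars_sum_square[OF finite_lessThan indZ Z2 Z0]
    let ?T = "\<lambda>\<omega>. (\<Sum>i<n. Z i \<omega>)"
    have sn: "sqrt (real n) > 0" using n by simp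
    \<comment> \<open>The terms with \<open>\<mu>\<close> cancel between \<open>Z\<close> and
      \<open>S\<close>, which leaves the normalised centred sum \<open>?T\<close> and a nonrandom
      remainder.\<close>
    have eq: "?A n \<omega> - (m + s * S n \<omega>) = ?T \<omega> / sqrt (real n) + (sqrt (real n) * (\<nu> n - c n) - m)" for \<omega>
    proof -
      have "?T \<omega> = (\<Sum>i<n. g n (X i \<omega>)) - (\<Sum>i<n. h (X i \<omega>) - \<mu>) - real n * \<nu> n"
        by (simp add: Z_def d_def sum_subtractf algebra_simps sum.distrib)
      then have T: "?T \<omega> / sqrt (real n) = (\<Sum>i<n. g n (X i \<omega>)) / sqrt (real n)
          - (\<Sum>i<n. h (X i \<omega>) - \<mu>) / sqrt (real n) - sqrt (real n) * \<nu> n"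
        using n by (simp add: diff_divide_distrib real_div_sqrt flip: times_divide_eq_left)
      have G: "?A n \<omega> = (\<Sum>i<n. g n (X i \<omega>)) / sqrt (real n) - sqrt (real n) * c n"
        using n by (simp add: right_diff_distrib) (simp add: field_simps)
      have "s * S n \<omega> = (\<Sum>i<n. h (X i \<omega>) - \<mu>) / sqrt (real n)"
        using s by (simp add: S_def real_sqrt_mult)
      with T G show ?thesis by (simp add: algebra_simps)
    qed
    have intT: "integrable M ?T"
      by (rule square_integrable_imp_integrable[OF _ conjunct1[OF sq]]) measurable
    have "expectation (\<lambda>\<omega>. \<bar>?T \<omega>\<bar>) \<le> sqrt (\<Sum>i<n. expectation (\<lambda>\<omega>. (Z i \<omega>)\<^sup>2))"
      using abs_expectation_le_sqrt[of ?T] sq by simp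
    also have "\<dots> \<le> sqrt (real n * (\<integral>y. (d y)\<^sup>2 \<partial>N))"
      using sum_mono[of "{..<n}", OF Z2_le] by simp
    finally have T_le: "expectation (\<lambda>\<omega>. \<bar>?T \<omega>\<bar>) / sqrt (real n) \<le> sqrt (\<integral>y. (d y)\<^sup>2 \<partial>N)"
      using sn by (simp add: real_sqrt_mult field_simps)
    have "expectation (\<lambda>\<omega>. \<bar>?A n \<omega> - (m + s * S n \<omega>)\<bar>)
        \<le> expectation (\<lambda>\<omega>. \<bar>?T \<omega>\<bar> / sqrt (real n) + \<bar>sqrt (real n) * (\<nu> n - c n) - m\<bar>)"
      unfolding eq using intT sn
      by (intro integral_mono) (auto intro!: abs_triangle_ineq[THEN order_trans])
    also have "\<dots> = expectation (\<lambda>\<omega>. \<bar>?T \<omega>\<bar>) / sqrt (real n) + \<bar>sqrt (real n) * (\<nu> n - c n) - m\<bar>"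
      using intT by (simp add: prob_space)
    finally show ?thesis
      unfolding eq using T_le intT by (simp add: d_def)
  qed
  show ?thesis
  proof (rule conv_in_law_normal_affine[OF _ _ conv s])
    show "integrable M (\<lambda>\<omega>. ?A n \<omega> - (m + s * S n \<omega>))" for n
      \<comment> \<open>For \<open>n = 0\<close> the factor \<open>sqrt (real n)\<close> and the
        empty sum in \<open>S\<close> make the difference the constant \<open>- m\<close>.\<close>
      using main[of n] by (cases "n = 0") (auto simp: S_def)
    have "(\<lambda>n. sqrt (\<integral>y. (g n y - h y)\<^sup>2 \<partial>N)) \<longlonglongrightarrow> sqrt 0"
      by (intro tendsto_intros L2)
    moreover have "(\<lambda>n. \<bar>sqrt (real n) * (\<nu> n - c n) - m\<bar>) \<longlonglongrightarrow> \<bar>m - m\<bar>"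
      unfolding \<nu>_def by (intro tendsto_intros bias)
    ultimately have "?E \<longlonglongrightarrow> 0"
      using tendsto_add by fastforce
    then show "(\<lambda>n. expectation (\<lambda>\<omega>. \<bar>?A n \<omega> - (m + s * S n \<omega>)\<bar>)) \<longlonglongrightarrow> 0"
    proof (rule Lim_null_comparison[rotated])
      show "\<forall>\<^sub>F n in sequentially. norm (expectation (\<lambda>\<omega>. \<bar>?A n \<omega> - (m + s * S n \<omega>)\<bar>)) \<le> ?E n"
        using eventually_gt_at_top[of 0]
      proof eventually_elim
        case (elim n)
        then show ?case using main[OF elim] by (simp add: integral_nonneg_AE)
      qed
    qed
  qed auto
qed

subsection \<open>Gamma and inverse Gamma laws\<close>

definition gamma_density :: "real \<Rightarrow> real \<Rightarrow> real" where
  "gamma_density \<alpha> s = indicator {0..} s * (s powr (\<alpha> - 1) * exp (- s)) / Gamma \<alpha>"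

definition gamma_law :: "real \<Rightarrow> real measure" where
  "gamma_law \<alpha> = density lborel (gamma_density \<alpha>)"

text \<open>An image measure, so that moments and tails reduce to Gamma integrals. The scale is
  \<open>1 / \<theta>\<close>, in the parametrisation of \<open>IGam_kernel\<close>; the HOL value
  of \<open>1 / (s * \<theta>)\<close> at \<open>s = 0\<close> concerns a null set.\<close>

definition inv_gamma_law :: "real \<Rightarrow> real \<Rightarrow> real measure" where
  "inv_gamma_law \<alpha> \<theta> = distr (gamma_law \<alpha>) borel (\<lambda>s. 1 / (s * \<theta>))"

lemma gamma_density_measurable [measurable]: "gamma_density \<alpha> \<in> borel_measurable borel"
  unfolding gamma_density_def by measurable

lemma gamma_density_nonneg: "\<alpha> > 0 \<Longrightarrow> 0 \<le> gamma_density \<alpha> s"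
  by (simp add: gamma_density_def Gamma_real_pos less_imp_le)

lemma sets_gamma_law [simp, measurable_cong]: "sets (gamma_law \<alpha>) = sets borel"
  by (simp add: gamma_law_def)

lemma space_gamma_law [simp]: "space (gamma_law \<alpha>) = UNIV"
  by (simp add: gamma_law_def)

lemma has_bochner_integral_Gamma:
  assumes "\<alpha> > 0"
  shows "has_bochner_integral lborel
    (\<lambda>s::real. indicator {0..} s * (s powr (\<alpha> - 1) * exp (- s))) (Gamma \<alpha>)"
proof (rule has_bochner_integral_nn_integral)
  show "(\<integral>\<^sup>+s. ennreal (indicator {0..} s * (s powr (\<alpha> - 1) * exp (- s))) \<partial>lborel) = ennreal (Gamma \<alpha>)"
    unfolding Gamma_conv_nn_integral_real[OF assms]
    by (intro nn_integral_cong) (simp add: exp_minus divide_inverse mult.assoc)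
qed (use assms in \<open>auto simp: Gamma_real_pos less_imp_le\<close>)

lemma AE_gamma_law_pos: "AE s in gamma_law \<alpha>. s > 0"
proof -
  have "AE s in lborel. ennreal (gamma_density \<alpha> s) > 0 \<longrightarrow> s > 0"
  proof (rule AE_I2)
    fix s :: real
    show "ennreal (gamma_density \<alpha> s) > 0 \<longrightarrow> s > 0"
      \<comment> \<open>At the endpoint 0 the density vanishes for every shape, as
        \<open>0 powr a = 0\<close> in HOL.\<close>
      by (cases "s = 0") (auto simp: gamma_density_def indicator_def split: if_splits)
  qed
  then show ?thesis
    unfolding gamma_law_def by (subst AE_density) auto
qed

text \<open>Dividing the Gamma density by \<open>s ^ k\<close> lowers the shape from
  \<open>\<alpha>\<close> to \<open>\<alpha> - real k\<close>, which the hypothesis keeps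
  positive.\<close>

lemma has_bochner_integral_gamma_law_power:
  assumes "real k < \<alpha>"
  shows "has_bochner_integral (gamma_law \<alpha>) (\<lambda>s. (1 / (s * \<theta>)) ^ k)
           ((1 / \<theta>) ^ k * Gamma (\<alpha> - real k) / Gamma \<alpha>)"
  unfolding gamma_law_def
proof (rule has_bochner_integral_density)
  have "gamma_density \<alpha> s *\<^sub>R (1 / (s * \<theta>)) ^ k =
      (1 / \<theta>) ^ k / Gamma \<alpha> * (indicator {0..} s * (s powr (\<alpha> - real k - 1) * exp (- s)))" for s
  proof (cases "s > 0")
    case True
    then have "s powr (\<alpha> - 1) = s powr (\<alpha> - real k - 1) * s ^ k"
      by (simp add: powr_realpow[symmetric] powr_add[symmetric])
    with True show ?thesis
      by (simp add: gamma_density_def power_mult_distrib power_divide)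
  next
    case False
    then show ?thesis
      by (cases "s = 0") (auto simp: gamma_density_def)
  qed
  moreover have "has_bochner_integral lborel (\<lambda>s::real. (1 / \<theta>) ^ k / Gamma \<alpha> *
      (indicator {0..} s * (s powr (\<alpha> - real k - 1) * exp (- s)))) ((1 / \<theta>) ^ k / Gamma \<alpha> * Gamma (\<alpha> - real k))"
    using assms by (intro has_bochner_integral_mult_right has_bochner_integral_Gamma) auto
  ultimately show "has_bochner_integral lborel
      (\<lambda>s. gamma_density \<alpha> s *\<^sub>R (1 / (s * \<theta>)) ^ k) ((1 / \<theta>) ^ k * Gamma (\<alpha> - real k) / Gamma \<alpha>)"
    by (simp only:) (simp add: mult.commute)
qed (use assms in \<open>auto intro!: gamma_density_nonneg\<close>)

text \<open>The total mass is the moment of order 0.\<close>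

lemma prob_space_gamma_law:
  assumes "\<alpha> > 0"
  shows "prob_space (gamma_law \<alpha>)"
proof
  have one: "has_bochner_integral (gamma_law \<alpha>) (\<lambda>_. 1::real) 1"
    using has_bochner_integral_gamma_law_power[of 0 \<alpha> 1] Gamma_real_pos[OF assms] assms by simp
  with nn_integral_eq_integral[of "gamma_law \<alpha>" "\<lambda>_. 1::real"]
  show "emeasure (gamma_law \<alpha>) (space (gamma_law \<alpha>)) = 1"
    by (simp add: has_bochner_integral_iff)
qed

lemma real_distribution_inv_gamma_law:
  "\<alpha> > 0 \<Longrightarrow> real_distribution (inv_gamma_law \<alpha> \<theta>)"
  unfolding inv_gamma_law_def
  by (intro prob_space.real_distribution_distr prob_space_gamma_law) auto

lemma AE_inv_gamma_law_pos:
  assumes "\<theta> > 0"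
  shows "AE w in inv_gamma_law \<alpha> \<theta>. w > 0"
  unfolding inv_gamma_law_def using AE_gamma_law_pos[of \<alpha>] assms
  by (subst AE_distr_iff) auto

lemma measure_gamma_law_atLeast:
  assumes "\<alpha> > 0" "z \<ge> 0"
  shows "measure (gamma_law \<alpha>) {z..} = upper_Gamma \<alpha> z / Gamma \<alpha>"
proof -
  interpret prob_space "gamma_law \<alpha>" by (rule prob_space_gamma_law) fact
  have "measure (gamma_law \<alpha>) {z..} = (\<integral>s. indicator {z..} s \<partial>gamma_law \<alpha>)"
    by simp
  also have "\<dots> = (\<integral>s. gamma_density \<alpha> s * indicator {z..} s \<partial>lborel)"
    unfolding gamma_law_def using assms by (subst integral_density) (auto simp: gamma_density_nonneg)
  also have "\<dots> = (\<integral>s. (indicator {z..} s * (s powr (\<alpha> - 1) * exp (- s))) / Gamma \<alpha> \<partial>lborel)"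
    using assms by (intro Bochner_Integration.integral_cong) (auto simp: gamma_density_def indicator_def)
  also have "\<dots> = upper_Gamma \<alpha> z / Gamma \<alpha>"
    by (simp add: upper_Gamma_def set_lebesgue_integral_def)
  finally show ?thesis .
qed

text \<open>For positive \<open>s\<close> and \<open>t\<close>, \<open>1 / (s * \<theta>)\<close>
  exceeds \<open>t\<close> exactly when \<open>s\<close> is below \<open>1 / (t * \<theta>)\<close>,
  so the tail is the complement of an upper Gamma tail. For \<open>t \<le> 0\<close> the tail has
  full mass, in agreement with the value 1 set in \<open>IGam_kernel\<close>. Both the mean and the
  mean-square error of the kernel are computed from this.\<close>

lemma IGam_kernel_eq_measure:
  assumes "\<alpha> > 0" "\<theta> > 0"
  shows "IGam_kernel t \<alpha> \<theta> = measure (inv_gamma_law \<alpha> \<theta>) {t<..}"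
proof -
  interpret prob_space "gamma_law \<alpha>" by (rule prob_space_gamma_law) fact
  have *: "measure (inv_gamma_law \<alpha> \<theta>) {t<..} = prob {s. t < 1 / (s * \<theta>)}"
    unfolding inv_gamma_law_def by (subst measure_distr) (auto simp: vimage_def)
  show ?thesis
  proof (cases "t > 0")
    case True
    have "prob {s. t < 1 / (s * \<theta>)} = prob (space (gamma_law \<alpha>) - {1 / (t * \<theta>)..})"
    proof (rule measure_eq_AE)
      show "AE s in gamma_law \<alpha>. s \<in> {s. t < 1 / (s * \<theta>)}
          \<longleftrightarrow> s \<in> space (gamma_law \<alpha>) - {1 / (t * \<theta>)..}"
        using AE_gamma_law_pos by eventually_elim (use True assms in \<open>auto simp: field_simps\<close>)
    qed auto
    also have "\<dots> = 1 - upper_Gamma \<alpha> (1 / (t * \<theta>)) / Gamma \<alpha>"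
      using True assms by (subst prob_compl) (auto simp: measure_gamma_law_atLeast)
    finally show ?thesis using True * by (simp add: IGam_kernel_def)
  next
    case False
    have "prob {s. t < 1 / (s * \<theta>)} = 1"
    proof (rule prob_eq_1[THEN iffD2])
      show "AE s in gamma_law \<alpha>. s \<in> {s. t < 1 / (s * \<theta>)}"
        using AE_gamma_law_pos
      proof eventually_elim
        case (elim s)
        then have "0 < 1 / (s * \<theta>)" using assms by simp
        with False show ?case by (simp only: mem_Collect_eq)
      qed
    qed auto
    with False * show ?thesis by (simp add: IGam_kernel_def)
  qed
qed

text \<open>Moving the lower limit of integration into the integrand makes
  \<open>upper_Gamma\<close> a parameter integral of a jointly measurable function.\<close>

lemma IGam_kernel_measurable [measurable]: "(\<lambda>t. IGam_kernel t \<alpha> \<theta>) \<in> borel_measurable borel"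
proof -
  have *: "upper_Gamma \<alpha> z = (\<integral>s. (if z \<le> s then s powr (\<alpha> - 1) * exp (- s) else 0) \<partial>lborel)" for z
    unfolding upper_Gamma_def set_lebesgue_integral_def
    by (intro Bochner_Integration.integral_cong) auto
  show ?thesis
    unfolding IGam_kernel_def * by measurable
qed

section \<open>Moments of the inverse Gamma law\<close>

text \<open>By the functional equation of \<open>Gamma\<close>, raising the order from
  \<open>j\<close> to \<open>j + 1\<close> multiplies the moment by
  \<open>(x / b) / (1 / b - j)\<close>, that is by \<open>x / (1 - j * b)\<close>. The hypothesis
  \<open>k\<close> keeps these denominators positive.\<close>

lemma has_bochner_integral_inv_gamma_power:
  fixes b x :: real
  assumes b: "b > 0" and x: "x > 0" and k: "real k * b < 1"
  shows "has_bochner_integral (inv_gamma_law (inverse b + 1) (inverse x * b)) (\<lambda>w. w ^ k)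
           (x ^ k / (\<Prod>j<k. 1 - real j * b))"
proof -
  let ?\<alpha> = "inverse b + 1" and ?\<theta> = "inverse x * b"
  have lt: "real j < inverse b" if "j \<le> k" for j
  proof -
    have "real j * b \<le> real k * b" using that b by (simp add: mult_right_mono)
    with k have "real j * b < 1" by linarith
    with b show ?thesis by (simp add: field_simps)
  qed
  have "(1 / ?\<theta>) ^ j * Gamma (?\<alpha> - real j) / Gamma ?\<alpha> = x ^ j / (\<Prod>i<j. 1 - real i * b)"
    if "j \<le> k" for j using that
  proof (induction j)
    case 0
    have "Gamma ?\<alpha> \<noteq> 0" using b Gamma_real_pos[of ?\<alpha>] by (smt (verit) positive_imp_inverse_positive)
    then show ?case by simp
  next
    case (Suc j)
    have pos: "inverse b - real j > 0" using lt[of j] Suc by simp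
    have nz: "1 - real j * b > 0" using pos b by (simp add: field_simps)
    have "Gamma (?\<alpha> - real j) = (inverse b - real j) * Gamma (inverse b - real j)"
      using Gamma_plus1[of "inverse b - real j"] pos
      by (simp add: algebra_simps nonpos_Ints_def)
    also have "\<dots> = (inverse b - real j) * Gamma (?\<alpha> - real (Suc j))"
      by simp
    finally have G: "Gamma (?\<alpha> - real (Suc j)) = Gamma (?\<alpha> - real j) / (inverse b - real j)"
      using pos by simp
    have c: "1 / ?\<theta> / (inverse b - real j) = x / (1 - real j * b)"
      using b pos nz x by (simp add: field_simps)
    have "(1 / ?\<theta>) ^ Suc j * Gamma (?\<alpha> - real (Suc j)) / Gamma ?\<alpha>
        = ((1 / ?\<theta>) ^ j * Gamma (?\<alpha> - real j) / Gamma ?\<alpha>) * (1 / ?\<theta> / (inverse b - real j))"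
      unfolding G by simp
    also have "\<dots> = x ^ j / (\<Prod>i<j. 1 - real i * b) * (x / (1 - real j * b))"
      unfolding c using Suc by simp
    finally show ?case by simp
  qed
  from this[of k] have "has_bochner_integral (gamma_law ?\<alpha>) (\<lambda>s. (1 / (s * ?\<theta>)) ^ k)
      (x ^ k / (\<Prod>j<k. 1 - real j * b))"
    using has_bochner_integral_gamma_law_power[of k ?\<alpha> ?\<theta>] lt[of k] by simp
  then show ?thesis
    unfolding inv_gamma_law_def by (subst has_bochner_integral_distr) auto
qed

text \<open>Binomial expansion into raw moments; \<open>b < 1 / 4\<close> makes those up to order 4
  available. The mean is exactly \<open>x\<close>, the second moment is of order \<open>b\<close>
  and the fourth of order \<open>b\<^sup>2\<close>.\<close>

lemma inv_gamma_central_moments: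
  fixes b x :: real
  assumes b: "b > 0" "b < 1 / 4" and x: "x > 0"
  defines "W \<equiv> inv_gamma_law (inverse b + 1) (inverse x * b)"
  shows "has_bochner_integral W (\<lambda>w. w - x) 0"
    and "has_bochner_integral W (\<lambda>w. (w - x)\<^sup>2) (x\<^sup>2 * (b / (1 - b)))"
    and "has_bochner_integral W (\<lambda>w. (w - x) ^ 4)
           (x ^ 4 * ((3 * b\<^sup>2 + 18 * b ^ 3) / ((1 - b) * (1 - 2 * b) * (1 - 3 * b))))"
proof -
  have m: "has_bochner_integral W (\<lambda>w. w ^ k) (x ^ k / (\<Prod>j<k. 1 - real j * b))" if "k \<le> 4" for k
  proof -
    have "real k * b \<le> 4 * b" using that b by (intro mult_right_mono) auto
    with b have "real k * b < 1" by linarith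
    with b show ?thesis
      unfolding W_def by (intro has_bochner_integral_inv_gamma_power x) auto
  qed
  have m0: "has_bochner_integral W (\<lambda>w. 1::real) 1"
    using m[of 0] by simp
  have m1: "has_bochner_integral W (\<lambda>w. w) x" using m[of 1] by simp
  have m2: "has_bochner_integral W (\<lambda>w. w\<^sup>2) (x\<^sup>2 / (1 - b))" 
    using m[of 2] by (simp add: eval_nat_numeral)
  have m3: "has_bochner_integral W (\<lambda>w. w ^ 3) (x ^ 3 / ((1 - b) * (1 - 2 * b)))"
    using m[of 3] by (simp add: eval_nat_numeral)
  have m4: "has_bochner_integral W (\<lambda>w. w ^ 4) (x ^ 4 / ((1 - b) * (1 - 2 * b) * (1 - 3 * b)))"
    using m[of 4] by (simp add: eval_nat_numeral)
  \<comment> \<open>Constants are written as multiples of 1 so that the introduction rules reach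
    \<open>m0\<close>.\<close>
  have "has_bochner_integral W (\<lambda>w. w - x * 1) (x - x * 1)"
    by (intro has_bochner_integral_diff has_bochner_integral_mult_right m0 m1)
  then show "has_bochner_integral W (\<lambda>w. w - x) 0" by simp
  have "has_bochner_integral W (\<lambda>w. w\<^sup>2 - 2 * x * w + x\<^sup>2 * 1) (x\<^sup>2 / (1 - b) - 2 * x * x + x\<^sup>2 * 1)"
    by (intro has_bochner_integral_diff has_bochner_integral_add has_bochner_integral_mult_right m0 m1 m2)
  moreover have "x\<^sup>2 / (1 - b) - 2 * x * x + x\<^sup>2 * 1 = x\<^sup>2 * (b / (1 - b))"
    using b by (simp add: divide_simps) (simp add: power2_eq_square algebra_simps)
  ultimately show "has_bochner_integral W (\<lambda>w. (w - x)\<^sup>2) (x\<^sup>2 * (b / (1 - b)))"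
    by (simp add: power2_diff algebra_simps)
  have "has_bochner_integral W (\<lambda>w. w ^ 4 - 4 * x * w ^ 3 + 6 * x\<^sup>2 * w\<^sup>2 - 4 * x ^ 3 * w + x ^ 4 * 1)
      (x ^ 4 / ((1 - b) * (1 - 2 * b) * (1 - 3 * b)) - 4 * x * (x ^ 3 / ((1 - b) * (1 - 2 * b)))
        + 6 * x\<^sup>2 * (x\<^sup>2 / (1 - b)) - 4 * x ^ 3 * x + x ^ 4 * 1)" (is "has_bochner_integral W _ ?I")
    by (intro has_bochner_integral_diff has_bochner_integral_add has_bochner_integral_mult_right m0 m1 m2 m3 m4)
  moreover have "?I = x ^ 4 * ((3 * b\<^sup>2 + 18 * b ^ 3) / ((1 - b) * (1 - 2 * b) * (1 - 3 * b)))"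
  proof -
    have "1 - b \<noteq> 0" "1 - 2 * b \<noteq> 0" "1 - 3 * b \<noteq> 0" using b by auto
    then show ?thesis by (simp add: divide_simps) algebra
  qed
  moreover have "w ^ 4 - 4 * x * w ^ 3 + 6 * x\<^sup>2 * w\<^sup>2 - 4 * x ^ 3 * w + x ^ 4 * 1 = (w - x) ^ 4" for w
    by algebra
  ultimately show "has_bochner_integral W (\<lambda>w. (w - x) ^ 4)
      (x ^ 4 * ((3 * b\<^sup>2 + 18 * b ^ 3) / ((1 - b) * (1 - 2 * b) * (1 - 3 * b))))"
    by simp
qed

subsection \<open>Bias and mean-square approximation\<close>

text \<open>For independent \<open>Y\<close> and \<open>V\<close> with laws \<open>N\<close> and
  \<open>W\<close>, both sides are the probability of \<open>Y < V\<close>, evaluated by Fubini in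
  the two orders. The hypothesis \<open>atom\<close> lets \<open>{..<w}\<close> be replaced by
  \<open>{..w}\<close>.\<close>

lemma integral_cdf_eq_integral_measure_greaterThan:
  fixes N W :: "real measure"
  assumes "real_distribution N" "real_distribution W" and atom: "AE w in W. measure N {w} = 0"
  shows "(\<integral>w. cdf N w \<partial>W) = (\<integral>y. measure W {y<..} \<partial>N)"
proof -
  interpret N: real_distribution N by fact
  interpret W: real_distribution W by fact
  interpret P: pair_prob_space N W ..
  have [measurable]: "Measurable.pred (N \<Otimes>\<^sub>M W) (\<lambda>p. fst p < snd p)"
    by measurable
  let ?f = "\<lambda>y w :: real. (if y < w then 1 else 0 :: real)"
  have "integrable (N \<Otimes>\<^sub>M W) (\<lambda>(y, w). ?f y w)"
    by (intro P.integrable_const_bound[where B = 1]) (auto simp: case_prod_beta)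
  from P.Fubini_integral[OF this]
  have "(\<integral>w. \<integral>y. ?f y w \<partial>N \<partial>W) = (\<integral>y. \<integral>w. ?f y w \<partial>W \<partial>N)" .
  moreover have "(\<integral>w. ?f y w \<partial>W) = measure W {y<..}" for y
  proof -
    have "?f y = indicator {y<..}" by auto
    then show ?thesis by simp
  qed
  moreover have "(\<integral>y. ?f y w \<partial>N) = measure N {..<w}" for w
  proof -
    have "(\<lambda>y. ?f y w) = indicator {..<w}" by auto
    then show ?thesis by simp
  qed
  moreover have "(\<integral>w. measure N {..<w} \<partial>W) = (\<integral>w. cdf N w \<partial>W)"
  proof (rule integral_cong_AE)
    show "(\<lambda>w. measure N {..<w}) \<in> borel_measurable W"
      by (intro W.measurable_finite_borel borel_measurable_mono monoI N.finite_measure_mono) auto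
    show "cdf N \<in> borel_measurable W"
      by (intro W.measurable_finite_borel borel_measurable_mono monoI N.cdf_nondecreasing)
    show "AE w in W. measure N {..<w} = cdf N w"
      using atom
    proof eventually_elim
      case (elim w)
      have "{..w} = {..<w} \<union> {w}" by auto
      then show ?case
        using N.finite_measure_Union[of "{..<w}" "{w}"] elim by (simp add: cdf_def)
    qed
  qed
  ultimately show ?thesis by simp
qed

section \<open>Second-order expansion of the mean\<close>

text \<open>Near \<open>x\<close> the derivative of the remainder is at most
  \<open>e * \<bar>w - x\<bar>\<close> along the segment, which gives the quadratic term. Away from
  \<open>x\<close> the remainder grows at most quadratically and is absorbed by the fourth power.
  The bound holds for all \<open>w\<close>, so it can be integrated against a law with unbounded
  support.\<close>

lemma second_order_expansion_bound:
  fixes F f :: "real \<Rightarrow> real"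
  assumes F: "\<And>y. y > 0 \<Longrightarrow> (F has_real_derivative f y) (at y)"
    and f: "(f has_real_derivative D) (at x)" and x: "x > 0"
    and bdd: "\<And>y. \<bar>F y - F x\<bar> \<le> 1" and e: "e > 0"
  obtains C where "C \<ge> 0"
    "\<And>w. \<bar>F w - F x - f x * (w - x) - D / 2 * (w - x)\<^sup>2\<bar> \<le> e * (w - x)\<^sup>2 + C * (w - x) ^ 4"
proof -
  from f e obtain d0 where d0: "d0 > 0"
    and d0': "\<And>y. \<bar>y - x\<bar> < d0 \<Longrightarrow> \<bar>f y - f x - D * (y - x)\<bar> \<le> e * \<bar>y - x\<bar>"
    unfolding has_field_derivative_def has_derivative_at_alt by force
  \<comment> \<open>The minimum with \<open>x\<close> keeps the segment from \<open>x\<close> to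
    \<open>w\<close> in the positive reals, where \<open>F\<close> is differentiable.\<close>
  define d where "d = min d0 x"
  have d: "d > 0" using d0 x by (simp add: d_def)
  \<comment> \<open>For \<open>u \<ge> d\<close> the three summands turn the terms of degree 0, 1
    and 2 in \<open>u\<close> into multiples of \<open>u ^ 4\<close>.\<close>
  define C where "C = 1 / d ^ 4 + \<bar>f x\<bar> / d ^ 3 + \<bar>D\<bar> / 2 / d\<^sup>2"
  have C: "C \<ge> 0" using d by (simp add: C_def)
  show thesis
  proof (rule that[OF C])
    fix w
    define h where "h y = F y - F x - f x * (y - x) - D / 2 * (y - x)\<^sup>2" for y
    have "\<bar>h w\<bar> \<le> e * (w - x)\<^sup>2 + C * (w - x) ^ 4"
    proof (cases "\<bar>w - x\<bar> < d")
      case True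
      have "norm (h w - h x) \<le> (e * \<bar>w - x\<bar>) * norm (w - x)"
      proof (rule field_differentiable_bound)
        fix z assume "z \<in> closed_segment x w"
        then have zx: "\<bar>z - x\<bar> \<le> \<bar>w - x\<bar>"
          by (auto simp: closed_segment_eq_real_ivl split: if_splits)
        with True have z: "z > 0" "\<bar>z - x\<bar> < d0" by (auto simp: d_def)
        have "(h has_real_derivative (f z - f x - D * (z - x))) (at z)"
          unfolding h_def by (rule derivative_eq_intros F z refl | simp)+
        then show "(h has_real_derivative (f z - f x - D * (z - x))) (at z within closed_segment x w)"
          by (rule has_field_derivative_at_within)
        have "\<bar>f z - f x - D * (z - x)\<bar> \<le> e * \<bar>z - x\<bar>" by (rule d0') fact
        also have "\<dots> \<le> e * \<bar>w - x\<bar>" using zx e by simp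
        finally show "norm (f z - f x - D * (z - x)) \<le> e * \<bar>w - x\<bar>" by simp
      qed auto
      moreover have "h x = 0" by (simp add: h_def)
      ultimately have "\<bar>h w\<bar> \<le> e * (w - x)\<^sup>2"
        by (simp add: power2_eq_square mult.assoc flip: abs_mult)
      with C show ?thesis by (simp add: add_increasing2)
    next
      case False
      define u where "u = \<bar>w - x\<bar>"
      have u: "u \<ge> d" "(w - x)\<^sup>2 = u\<^sup>2" "(w - x) ^ 4 = u ^ 4"
        using False by (simp_all add: u_def power_even_abs)
      have "\<bar>h w\<bar> \<le> \<bar>F w - F x\<bar> + \<bar>f x * (w - x)\<bar> + \<bar>D / 2 * (w - x)\<^sup>2\<bar>"
        unfolding h_def by linarith
      also have "\<dots> \<le> 1 + \<bar>f x\<bar> * u + \<bar>D\<bar> / 2 * u\<^sup>2"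
        using bdd[of w] by (simp add: u_def abs_mult)
      also have "\<dots> \<le> u ^ 4 / d ^ 4 + \<bar>f x\<bar> * (u ^ 4 / d ^ 3) + \<bar>D\<bar> / 2 * (u ^ 4 / d\<^sup>2)"
      proof -
        have "d ^ 4 \<le> u ^ 4" "d ^ 3 \<le> u ^ 3" "d\<^sup>2 \<le> u\<^sup>2"
          using u d by (auto intro: power_mono)
        moreover from this have "u * d ^ 3 \<le> u * u ^ 3" "u\<^sup>2 * d\<^sup>2 \<le> u\<^sup>2 * u\<^sup>2"
          by (intro mult_left_mono; use u d in simp)+
        ultimately have "1 \<le> u ^ 4 / d ^ 4" "u \<le> u ^ 4 / d ^ 3" "u\<^sup>2 \<le> u ^ 4 / d\<^sup>2"
          using d by (simp_all add: pos_le_divide_eq power2_eq_square eval_nat_numeral)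
        then show ?thesis by (intro add_mono mult_left_mono) auto
      qed
      also have "\<dots> = C * (w - x) ^ 4"
        by (simp add: C_def u algebra_simps)
      finally show ?thesis using e by (simp add: add_increasing)
    qed
    then show "\<bar>F w - F x - f x * (w - x) - D / 2 * (w - x)\<^sup>2\<bar> \<le> e * (w - x)\<^sup>2 + C * (w - x) ^ 4"
      by (simp add: h_def)
  qed
qed

text \<open>In the integrated expansion the linear term vanishes and the quadratic one gives
  \<open>D / 2\<close> times the variance. After division by \<open>b\<close> the remainder is at
  most a multiple of \<open>e\<close>, which is arbitrary, plus a term of order
  \<open>b\<close>.\<close>

lemma inv_gamma_expectation_expansion:
  fixes F f :: "real \<Rightarrow> real"
  assumes F: "\<And>y. y > 0 \<Longrightarrow> (F has_real_derivative f y) (at y)"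
    and f: "(f has_real_derivative D) (at x)" and x: "x > 0"
    and F01: "\<And>y. 0 \<le> F y" "\<And>y. F y \<le> 1" and meas: "F \<in> borel_measurable borel"
  shows "((\<lambda>b. ((\<integral>w. F w \<partial>inv_gamma_law (inverse b + 1) (inverse x * b)) - F x) / b)
            \<longlongrightarrow> x\<^sup>2 * D / 2) (at_right 0)"
proof -
  let ?W = "\<lambda>b. inv_gamma_law (inverse b + 1) (inverse x * b)"
  let ?m = "\<lambda>b. ((\<integral>w. F w \<partial>?W b) - F x) / b"
  \<comment> \<open>The fourth central moment divided by \<open>b\<close>, which tends to 0 with
    \<open>b\<close>.\<close>
  let ?q = "\<lambda>b. x ^ 4 * ((3 * b + 18 * b\<^sup>2) / ((1 - b) * (1 - 2 * b) * (1 - 3 * b)))"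
  have small: "\<forall>\<^sub>F b in at_right 0. 0 < b \<and> b < (1/4 :: real)"
    using eventually_at_right_real[of 0 "1 / 4 :: real"] by (auto elim: eventually_mono)
  have bdd: "\<bar>F y - F x\<bar> \<le> 1" for y
    using F01(1)[of x] F01(2)[of x] F01(1)[of y] F01(2)[of y] by linarith
  have "((\<lambda>b. ?m b - D / 2 * (x\<^sup>2 / (1 - b))) \<longlongrightarrow> 0) (at_right 0)"
  proof (rule tendstoI)
    fix r :: real assume r: "r > 0"
    \<comment> \<open>Chosen so that the limit \<open>e * x\<^sup>2\<close> of the error bound is
      \<open>r / 2\<close>.\<close>
    define e where "e = r / (2 * x\<^sup>2)"
    have e: "e > 0" using r x by (simp add: e_def)
    obtain C where C: "C \<ge> 0" and C': "\<And>w. \<bar>F w - F x - f x * (w - x) - D / 2 * (w - x)\<^sup>2\<bar>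
        \<le> e * (w - x)\<^sup>2 + C * (w - x) ^ 4"
      using second_order_expansion_bound[OF F f x bdd e] by blast
    have "((\<lambda>b. e * (x\<^sup>2 / (1 - b)) + C * ?q b) \<longlongrightarrow> e * (x\<^sup>2 / (1 - 0))
       + C * (x ^ 4 * ((3 * 0 + 18 * 0\<^sup>2) / ((1 - 0) * (1 - 2 * 0) * (1 - 3 * 0))))) (at_right 0)"
      by (intro tendsto_intros) auto
    then have "((\<lambda>b. e * (x\<^sup>2 / (1 - b)) + C * ?q b) \<longlongrightarrow> e * x\<^sup>2) (at_right 0)"
      by simp
    then have "\<forall>\<^sub>F b in at_right 0. e * (x\<^sup>2 / (1 - b)) + C * ?q b < r"
      by (rule order_tendstoD) (use r x in \<open>simp add: e_def\<close>)
    with small show "\<forall>\<^sub>F b in at_right 0. dist (?m b - D / 2 * (x\<^sup>2 / (1 - b))) 0 < r"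
    proof eventually_elim
      case (elim b)
      then have b: "0 < b" "b < 1 / 4" by auto
      interpret W: real_distribution "?W b"
        using b by (intro real_distribution_inv_gamma_law) (simp add: add_pos_pos)
      note mom = inv_gamma_central_moments[OF b x]
      have intF: "integrable (?W b) F"
        using F01 meas by (intro W.integrable_const_bound[where B = 1]) auto
      let ?h = "\<lambda>w. F w - F x - f x * (w - x) - D / 2 * (w - x)\<^sup>2"
      have h: "has_bochner_integral (?W b) ?h
          ((\<integral>w. F w \<partial>?W b) - F x - f x * 0 - D / 2 * (x\<^sup>2 * (b / (1 - b))))"
        using W.prob_space
        by (intro has_bochner_integral_diff has_bochner_integral_mult_right mom)
           (use intF in \<open>auto simp: has_bochner_integral_iff\<close>)
      have bound: "has_bochner_integral (?W b) (\<lambda>w. e * (w - x)\<^sup>2 + C * (w - x) ^ 4)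
          (e * (x\<^sup>2 * (b / (1 - b))) + C * (x ^ 4 * ((3 * b\<^sup>2 + 18 * b ^ 3) / ((1 - b) * (1 - 2 * b) * (1 - 3 * b)))))"
        by (intro has_bochner_integral_add has_bochner_integral_mult_right mom)
      have "\<bar>\<integral>w. ?h w \<partial>?W b\<bar> \<le> (\<integral>w. \<bar>?h w\<bar> \<partial>?W b)"
        by (rule integral_abs_bound)
      also have "\<dots> \<le> (\<integral>w. e * (w - x)\<^sup>2 + C * (w - x) ^ 4 \<partial>?W b)"
        by (rule integral_mono)
           (use h bound C' in \<open>auto simp: has_bochner_integral_iff\<close>)
      also have "\<dots> = (e * (x\<^sup>2 / (1 - b)) + C * ?q b) * b"
        unfolding has_bochner_integral_integral_eq[OF bound]
        by (simp add: algebra_simps power2_eq_square power3_eq_cube add_divide_distrib)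
      finally have "\<bar>(\<integral>w. F w \<partial>?W b) - F x - D / 2 * (x\<^sup>2 * (b / (1 - b)))\<bar>
          \<le> (e * (x\<^sup>2 / (1 - b)) + C * ?q b) * b"
        unfolding has_bochner_integral_integral_eq[OF h] by simp
      moreover have "(\<integral>w. F w \<partial>?W b) - F x - D / 2 * (x\<^sup>2 * (b / (1 - b)))
          = (?m b - D / 2 * (x\<^sup>2 / (1 - b))) * b"
        using b by (simp only: left_diff_distrib) simp
      ultimately have "\<bar>?m b - D / 2 * (x\<^sup>2 / (1 - b))\<bar> \<le> e * (x\<^sup>2 / (1 - b)) + C * ?q b"
        using b by (simp add: abs_mult)
      with elim show ?case by simp
    qed
  qed
  moreover have "((\<lambda>b. D / 2 * (x\<^sup>2 / (1 - b))) \<longlongrightarrow> D / 2 * (x\<^sup>2 / (1 - 0))) (at_right 0)"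
    by (intro tendsto_intros) auto
  ultimately have "((\<lambda>b. (?m b - D / 2 * (x\<^sup>2 / (1 - b))) + D / 2 * (x\<^sup>2 / (1 - b)))
      \<longlongrightarrow> 0 + D / 2 * (x\<^sup>2 / (1 - 0))) (at_right 0)"
    by (rule tendsto_add)
  then show ?thesis by (simp add: mult.commute)
qed

section \<open>Convergence of the kernels to an indicator\<close>

lemma IGam_kernel_bounds:
  assumes "\<alpha> > 0" "\<theta> > 0"
  shows "0 \<le> IGam_kernel t \<alpha> \<theta>" "IGam_kernel t \<alpha> \<theta> \<le> 1"
proof -
  interpret W: real_distribution "inv_gamma_law \<alpha> \<theta>"
    by (rule real_distribution_inv_gamma_law) fact
  show "0 \<le> IGam_kernel t \<alpha> \<theta>" "IGam_kernel t \<alpha> \<theta> \<le> 1"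
    using assms by (simp_all add: IGam_kernel_eq_measure)
qed

text \<open>The error is the mass of \<open>{..y}\<close> if \<open>y < x\<close> and of
  \<open>{y<..}\<close> if \<open>y > x\<close>. Either event forces a deviation of at least
  \<open>\<bar>y - x\<bar>\<close> from the mean \<open>x\<close>, so Chebyshev's inequality
  applies.\<close>

lemma IGam_kernel_minus_indicator_le:
  assumes b: "0 < b" "b < 1 / 4" and x: "x > 0" and y: "y \<noteq> x"
  shows "\<bar>IGam_kernel y (inverse b + 1) (inverse x * b) - indicator {..x} y\<bar>
           \<le> x\<^sup>2 * (b / (1 - b)) / (y - x)\<^sup>2"
proof -
  let ?W = "inv_gamma_law (inverse b + 1) (inverse x * b)"
  have pos: "inverse b + 1 > 0" "inverse x * b > 0" using b x by (simp_all add: add_pos_pos)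
  interpret W: real_distribution ?W
    by (rule real_distribution_inv_gamma_law) fact
  note mom = inv_gamma_central_moments[OF b x]
  have intW: "integrable ?W (\<lambda>w. w)"
    using Bochner_Integration.integrable_add[OF integrable.intros[OF mom(1)] W.integrable_const[of x]] by simp
  have mean: "W.expectation (\<lambda>w. w) = x"
    using has_bochner_integral_integral_eq[OF mom(1)] intW W.prob_space by simp
  have "integrable ?W (\<lambda>w. (w - x)\<^sup>2 + 2 * x * w - x\<^sup>2)"
    using intW integrable.intros[OF mom(2)] by simp
  then have intW2: "integrable ?W (\<lambda>w. w\<^sup>2)"
    by (simp add: power2_diff)
  have var: "W.variance (\<lambda>w. w) = x\<^sup>2 * (b / (1 - b))"
    unfolding mean using has_bochner_integral_integral_eq[OF mom(2)] by simp
  have cheb: "W.prob {w. \<bar>y - x\<bar> \<le> \<bar>w - x\<bar>} \<le> x\<^sup>2 * (b / (1 - b)) / (y - x)\<^sup>2"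
    using W.Chebyshev_inequality[of "\<lambda>w. w" "\<bar>y - x\<bar>"] intW2 y
    \<comment> \<open>The order matters: the left side of \<open>var\<close> contains the
      expectation that \<open>mean\<close> rewrites.\<close>
    unfolding var unfolding mean by simp
  show ?thesis
  proof (cases "y < x")
    case True
    have "{..y} = space ?W - {y<..}" by auto
    then have "W.prob {..y} = 1 - W.prob {y<..}"
      using W.prob_compl[of "{y<..}"] by simp
    moreover have "W.prob {..y} \<le> W.prob {w. \<bar>y - x\<bar> \<le> \<bar>w - x\<bar>}"
      using True by (intro W.finite_measure_mono) auto
    ultimately show ?thesis
      using True cheb by (simp add: IGam_kernel_eq_measure[OF pos])
  next
    case False
    have "W.prob {y<..} \<le> W.prob {w. \<bar>y - x\<bar> \<le> \<bar>w - x\<bar>}"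
      using False by (intro W.finite_measure_mono) auto
    then show ?thesis
      using False y cheb by (simp add: IGam_kernel_eq_measure[OF pos])
  qed
qed

text \<open>Dominated convergence with bound 1, since kernel and indicator lie between 0 and 1.
  Pointwise convergence comes from the Chebyshev bound off the null set \<open>{x}\<close>.\<close>

lemma IGam_kernel_L2_tendsto_indicator:
  fixes b :: "nat \<Rightarrow> real"
  assumes "real_distribution N" and atom: "measure N {x} = 0" and x: "x > 0"
    and b_pos: "\<And>n. n \<ge> 1 \<Longrightarrow> b n > 0" and b_lim: "b \<longlonglongrightarrow> 0"
  shows "(\<lambda>n. \<integral>y. (IGam_kernel y (inverse (b n) + 1) (inverse x * b n) - indicator {..x} y)\<^sup>2 \<partial>N)
           \<longlonglongrightarrow> 0"
\<comment> \<open>The shift avoids \<open>b 0\<close>, whose sign is unknown.\<close>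
proof (rule LIMSEQ_imp_Suc)
  interpret N: real_distribution N by fact
  let ?d = "\<lambda>n y. IGam_kernel y (inverse (b (Suc n)) + 1) (inverse x * b (Suc n)) - indicator {..x} y :: real"
  have lim: "(\<lambda>n. b (Suc n)) \<longlonglongrightarrow> 0" using b_lim by (rule LIMSEQ_Suc)
  have pos: "inverse (b (Suc n)) + 1 > 0" "inverse x * b (Suc n) > 0" for n
    using b_pos[of "Suc n"] x by (simp_all add: add_pos_pos)
  have "(\<lambda>n. \<integral>y. (?d n y)\<^sup>2 \<partial>N) \<longlonglongrightarrow> (\<integral>y. 0 \<partial>N)"
  proof (rule integral_dominated_convergence[where w = "\<lambda>_. 1"])
    show "AE y in N. (\<lambda>n. (?d n y)\<^sup>2) \<longlonglongrightarrow> 0"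
    proof -
      have "AE y in N. y \<noteq> x"
        using atom by (intro AE_I[where N = "{x}"]) (auto simp: N.emeasure_eq_measure)
      then show ?thesis
      proof eventually_elim
        case (elim y)
        have "(\<lambda>n. ?d n y) \<longlonglongrightarrow> 0"
        proof (rule Lim_null_comparison)
          have "\<forall>\<^sub>F n in sequentially. b (Suc n) < 1 / 4"
            using lim by (rule order_tendstoD) simp
          then show "\<forall>\<^sub>F n in sequentially. norm (?d n y) \<le> x\<^sup>2 * (b (Suc n) / (1 - b (Suc n))) / (y - x)\<^sup>2"
          proof eventually_elim
            case (elim n)
            show ?case
              unfolding real_norm_def
              using elim b_pos[of "Suc n"] x \<open>y \<noteq> x\<close> by (intro IGam_kernel_minus_indicator_le) auto
          qed
          have "(\<lambda>n. x\<^sup>2 * (b (Suc n) / (1 - b (Suc n))) / (y - x)\<^sup>2) \<longlonglongrightarrow> x\<^sup>2 * (0 / (1 - 0)) / (y - x)\<^sup>2"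
            using elim by (intro tendsto_intros lim) auto
          then show "(\<lambda>n. x\<^sup>2 * (b (Suc n) / (1 - b (Suc n))) / (y - x)\<^sup>2) \<longlonglongrightarrow> 0" by simp
        qed
        from tendsto_power[OF this, of 2] show ?case by simp
      qed
    qed
    show "AE y in N. norm ((?d n y)\<^sup>2) \<le> 1" for n
    proof (rule AE_I2)
      fix y
      have "\<bar>?d n y\<bar> \<le> 1"
        using IGam_kernel_bounds[OF pos(1)[of n] pos(2)[of n], of y] by (auto simp: indicator_def)
      then show "norm ((?d n y)\<^sup>2) \<le> 1"
        by (simp add: abs_square_le_1)
    qed
  qed (auto simp: measurable_cong_sets[OF N.events_eq_borel refl])
  then show "(\<lambda>n. \<integral>y. (?d n y)\<^sup>2 \<partial>N) \<longlonglongrightarrow> 0" by simp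
qed

subsection \<open>Asymptotic normality\<close>

theorem proposition5p4:
  fixes M :: "'a measure"
    and X :: "nat \<Rightarrow> 'a \<Rightarrow> real"
    and F f f' :: "real \<Rightarrow> real"
    and b :: "nat \<Rightarrow> real"
    and x :: real
  assumes "prob_space M"
    and X_indep: "prob_space.indep_vars M (\<lambda>_. borel) X UNIV"
    and X_cdf: "\<And>i. cdf (distr M borel (X i)) = F"
    and F_supp: "\<And>y. y < 0 \<Longrightarrow> F y = 0"
    and F_deriv: "\<And>y. y \<ge> 0 \<Longrightarrow> (F has_real_derivative f y) (at y within {0..})"
    and f_deriv: "\<And>y. y \<ge> 0 \<Longrightarrow> (f has_real_derivative f' y) (at y within {0..})"
    and f_cont: "continuous_on {0..} f" and f_bdd: "bounded (f ` {0..})"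
    and f'_cont: "continuous_on {0..} f'" and f'_bdd: "bounded (f' ` {0..})"
    and b_pos: "\<And>n. n \<ge> 1 \<Longrightarrow> b n > 0"
    and b_lim: "b \<longlonglongrightarrow> 0"
    and x_pos: "x > 0"
    and F_x: "0 < F x" "F x < 1"
  shows "conv_in_law M
           (\<lambda>n \<omega>. sqrt (real n) * (IGam_cdf_estimator X n (b n) x \<omega>
              - prob_space.expectation M (IGam_cdf_estimator X n (b n) x)))
           (normal_law 0 (F x * (1 - F x)))
       \<and> ((\<lambda>n. sqrt (real n) * b n) \<longlonglongrightarrow> 0 \<longrightarrow>
           conv_in_law M
             (\<lambda>n \<omega>. sqrt (real n) * (IGam_cdf_estimator X n (b n) x \<omega> - F x))
             (normal_law 0 (F x * (1 - F x))))
       \<and> (\<forall>L::real. L > 0 \<longrightarrow> (\<lambda>n. sqrt (real n) * b n) \<longlonglongrightarrow> L \<longrightarrow>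
           conv_in_law M
             (\<lambda>n \<omega>. sqrt (real n) * (IGam_cdf_estimator X n (b n) x \<omega> - F x))
             (normal_law (L * (x\<^sup>2 * f' x / 2)) (F x * (1 - F x))))"
proof -
  interpret prob_space M by fact
  have X[measurable]: "random_variable borel (X i)" for i
    using X_indep by (auto simp: indep_vars_def)
  define N where "N = distr M borel (X 0)"
  interpret N: real_distribution N
    unfolding N_def by simp
  \<comment> \<open>Equality of the distribution functions yields equality of the laws.\<close>
  have distr_X: "distr M borel (X i) = N" for i
    unfolding N_def by (rule cdf_unique) (simp_all add: X_cdf)
  have cdf_N: "cdf N = F" unfolding N_def by (rule X_cdf)
  have within: "at y within {0..} = at y" if "y > 0" for y :: real
    using that by (intro at_within_interior) auto
  have F': "(F has_real_derivative f y) (at y)" if "y > 0" for y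
    using F_deriv[of y] within[OF that] that by simp
  have f'_x: "(f has_real_derivative f' x) (at x)"
    using f_deriv[of x] within[OF x_pos] x_pos by simp
  have F01: "0 \<le> F y" "F y \<le> 1" for y
    using N.cdf_nonneg[of y] N.cdf_bounded_prob[of y] by (simp_all add: cdf_N)
  have F_meas: "F \<in> borel_measurable borel"
    unfolding cdf_N[symmetric] by (intro borel_measurable_mono monoI N.cdf_nondecreasing)
  \<comment> \<open>Differentiability gives continuity of \<open>F\<close> at positive points only;
    an atom at 0 remains possible.\<close>
  have atom: "measure N {y} = 0" if "y > 0" for y
    using N.isCont_cdf[of y] DERIV_isCont[OF F'[OF that]] by (simp add: cdf_N)
  let ?\<alpha> = "\<lambda>n. inverse (b n) + 1" and ?\<theta> = "\<lambda>n. inverse x * b n"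
  have pos: "?\<alpha> n > 0" "?\<theta> n > 0" if "n > 0" for n
    using b_pos[of n] x_pos that by (simp_all add: add_pos_pos)
  define g where "g n y = IGam_kernel y (?\<alpha> n) (?\<theta> n)" for n y
  define h :: "real \<Rightarrow> real" where "h = indicator {..x}"
  have g_meas[measurable]: "g n \<in> borel_measurable borel" for n
    unfolding g_def by measurable
  have h_meas[measurable]: "h \<in> borel_measurable borel"
    unfolding h_def by measurable
  have g01: "0 \<le> g n y" "g n y \<le> 1" if "n > 0" for n y
    using IGam_kernel_bounds[OF pos[OF that]] by (simp_all add: g_def)
  define s where "s = sqrt (F x * (1 - F x))"
  have s: "s > 0" "s\<^sup>2 = F x * (1 - F x)"
    using F_x by (simp_all add: s_def)
  have int_h: "(\<integral>y. h y \<partial>N) = F x"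
    unfolding h_def cdf_N[symmetric] cdf_def by simp
  have h_sq: "(h y)\<^sup>2 = h y" for y by (simp add: h_def indicator_def)
  have h_integrable: "integrable N h"
    by (intro N.integrable_const_bound[where B = 1]) (auto simp: h_def indicator_def)
  \<comment> \<open>An indicator is its own square, so its variance is its mean minus the square of
    its mean.\<close>
  have var_h: "(\<integral>y. (h y - (\<integral>z. h z \<partial>N))\<^sup>2 \<partial>N) = s\<^sup>2"
    using h_integrable
    by (subst N.variance_eq) (simp_all add: h_sq int_h s(2) right_diff_distrib flip: power2_eq_square)
  have mean_g: "(\<integral>y. g n y \<partial>N) = (\<integral>w. F w \<partial>inv_gamma_law (?\<alpha> n) (?\<theta> n))" if n: "n > 0" for n
  proof -
    \<comment> \<open>The inverse Gamma law charges only positive points, so a possible atom of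
      \<open>N\<close> at 0 does no harm.\<close>
    have "AE w in inv_gamma_law (?\<alpha> n) (?\<theta> n). measure N {w} = 0"
      using AE_inv_gamma_law_pos[OF pos(2)[OF n]] by eventually_elim (rule atom)
    from integral_cdf_eq_integral_measure_greaterThan[OF _ _ this]
    show ?thesis
      using pos[OF n]
      by (simp add: g_def IGam_kernel_eq_measure cdf_N N.real_distribution_axioms
          real_distribution_inv_gamma_law)
  qed
  \<comment> \<open>All three limits are instances: \<open>c n\<close> is the mean of the estimator
    or the constant \<open>F x\<close>, and \<open>m\<close> is the limit of the rescaled
    bias.\<close>
  have clt: "conv_in_law M (\<lambda>n \<omega>. sqrt (real n) * (IGam_cdf_estimator X n (b n) x \<omega> - c n))
      (normal_law m (F x * (1 - F x)))"
    if bias: "(\<lambda>n. sqrt (real n) * ((\<integral>y. g n y \<partial>N) - c n)) \<longlonglongrightarrow> m" for c m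
    unfolding IGam_cdf_estimator_def g_def[symmetric] s(2)[symmetric]
  proof (rule clt_triangular_perturbation[OF X_indep distr_X g_meas h_meas _ _ s(1) var_h _ bias])
    show "integrable N (\<lambda>y. (g n y)\<^sup>2)" if "n > 0" for n
      using g01[OF that]
      by (intro N.integrable_const_bound[where B = 1]) (auto simp: abs_square_le_1)
    show "integrable N (\<lambda>y. (h y)\<^sup>2)"
      using h_integrable by (simp add: h_sq)
    show "(\<lambda>n. \<integral>y. (g n y - h y)\<^sup>2 \<partial>N) \<longlonglongrightarrow> 0"
      unfolding g_def h_def
      by (rule IGam_kernel_L2_tendsto_indicator[OF N.real_distribution_axioms atom[OF x_pos] x_pos b_pos b_lim])
  qed
  have mean_estimator: "expectation (IGam_cdf_estimator X n (b n) x) = (\<integral>y. g n y \<partial>N)" if n: "n > 0" for n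
  proof -
    have "integrable M (\<lambda>\<omega>. g n (X i \<omega>))" for i
      using g01[OF n] by (intro integrable_const_bound[where B = 1]) auto
    moreover have "expectation (\<lambda>\<omega>. g n (X i \<omega>)) = (\<integral>y. g n y \<partial>N)" for i
      unfolding distr_X[of i, symmetric] by (simp add: integral_distr)
    ultimately show ?thesis
      using n unfolding IGam_cdf_estimator_def[abs_def] g_def[symmetric] by simp
  qed
  \<comment> \<open>The rescaled bias is \<open>sqrt (real n) * b n\<close> times the bias divided
    by \<open>b n\<close>. Taking \<open>L = 0\<close> covers the second claim, a positive
    \<open>L\<close> the third.\<close>
  have bias_F: "(\<lambda>n. sqrt (real n) * ((\<integral>y. g n y \<partial>N) - F x)) \<longlonglongrightarrow> L * (x\<^sup>2 * f' x / 2)"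
    if L: "(\<lambda>n. sqrt (real n) * b n) \<longlonglongrightarrow> L" for L
  proof -
    have "filterlim b (at_right 0) sequentially"
      using b_lim eventually_mono[OF eventually_ge_at_top[of 1] b_pos]
      by (rule tendsto_imp_filterlim_at_right)
    from tendsto_mult[OF L filterlim_compose[OF inv_gamma_expectation_expansion[OF F' f'_x x_pos F01 F_meas] this]]
    show ?thesis
    proof (rule Lim_transform_eventually)
      show "\<forall>\<^sub>F n in sequentially. sqrt (real n) * b n *
          (((\<integral>w. F w \<partial>inv_gamma_law (?\<alpha> n) (?\<theta> n)) - F x) / b n)
          = sqrt (real n) * ((\<integral>y. g n y \<partial>N) - F x)"
        using eventually_gt_at_top[of 0]
      proof eventually_elim
        case (elim n)
        with b_pos[of n] show ?case by (simp add: mean_g)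
      qed
    qed
  qed
  show ?thesis
  proof (intro conjI allI impI)
    show "conv_in_law M
       (\<lambda>n \<omega>. sqrt (real n) * (IGam_cdf_estimator X n (b n) x \<omega>
          - expectation (IGam_cdf_estimator X n (b n) x)))
       (normal_law 0 (F x * (1 - F x)))"
    proof (rule clt)
      \<comment> \<open>For \<open>n > 0\<close> the centring is exact, so the sequence is
        eventually constant 0.\<close>
      show "(\<lambda>n. sqrt (real n) * ((\<integral>y. g n y \<partial>N) - expectation (IGam_cdf_estimator X n (b n) x))) \<longlonglongrightarrow> 0"
        by (rule tendsto_eventually, rule eventually_mono[OF eventually_gt_at_top[of 0]])
           (simp add: mean_estimator)
    qed
  next
    assume "(\<lambda>n. sqrt (real n) * b n) \<longlonglongrightarrow> 0"
    from clt[OF bias_F[OF this]]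
    show "conv_in_law M (\<lambda>n \<omega>. sqrt (real n) * (IGam_cdf_estimator X n (b n) x \<omega> - F x))
        (normal_law 0 (F x * (1 - F x)))"
      by simp
  next
    fix L :: real
    assume "(\<lambda>n. sqrt (real n) * b n) \<longlonglongrightarrow> L"
    from clt[OF bias_F[OF this]]
    show "conv_in_law M (\<lambda>n \<omega>. sqrt (real n) * (IGam_cdf_estimator X n (b n) x \<omega> - F x))
        (normal_law (L * (x\<^sup>2 * f' x / 2)) (F x * (1 - F x)))" .
  qed
qed

end
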